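(* For any fixed weight $w\ge 1$, there are at most finitely many cyclic optimal constant-weight Gray codes of weight $w$ for $(1,2,n)$-LRM (with $n$ ranging over all integers $n>w$) for which $\gcd(n,w)\neq 1$.
   Context: Write a binary string of length $n$ as $v=v_0v_1\cdots v_{n-1}$ with indices taken modulo $n$. Let $S(n,w)$ be the set of binary strings of length $n$ with exactly $w$ ones (weight $w$); strings used in codes are never all-zeros or all-ones, so $1\le w\le n-1$. For $0\le j\le n-1$, the string $v'=\tau_j(v)$ is given by $v'_j=0$, $v'_{j+1}=1$ (index mod $n$), and $v'_k=v_k$ for all other $k$. A constant-weight Gray code of weight $w$ and size $N$ for $(1,2,n)$-LRM ("local rank modulation") is a sequence $G=g_0,\dots,g_{N-1}$ of distinct strings in $S(n,w)$ such that for every $0\le i\le N-2$ there is a $j$ with $g_{i+1}=\tau_j(g_i)$. It is cyclic if in addition $g_0=\tau_j(g_{N-1})$ for some $j$. It is optimal if $N=\binom{n}{w}$. *)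

theory Defs
  imports Main
begin

text \<open>Binary strings are Boolean lists, with \<open>True\<close> for the symbol 1.\<close>

definition weight_strings :: "nat \<Rightarrow> nat \<Rightarrow> bool list set" where
  "weight_strings n w = {v. length v = n \<and> count_list v True = w}"

definition tau :: "nat \<Rightarrow> bool list \<Rightarrow> bool list" where
  "tau j v = v[j := False, Suc j mod length v := True]"

text \<open>A code \<open>g 0, \<dots>, g (N - 1)\<close> is the list of its members in order, so its size \<open>N\<close> is the
  length of the list.\<close>

definition cw_gray_code :: "nat \<Rightarrow> nat \<Rightarrow> bool list list \<Rightarrow> bool" where
  "cw_gray_code n w G \<longleftrightarrow>
     1 \<le> w \<and> w < n \<and> distinct G \<and> set G \<subseteq> weight_strings n w \<and>
     (\<forall>i. Suc i < length G \<longrightarrow> (\<exists>j<n. G ! Suc i = tau j (G ! i)))"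

definition cyclic_cw_gray_code :: "nat \<Rightarrow> nat \<Rightarrow> bool list list \<Rightarrow> bool" where
  "cyclic_cw_gray_code n w G \<longleftrightarrow>
     cw_gray_code n w G \<and> G \<noteq> [] \<and> (\<exists>j<n. hd G = tau j (last G))"

definition optimal_cw_gray_code :: "nat \<Rightarrow> nat \<Rightarrow> bool list list \<Rightarrow> bool" where
  "optimal_cw_gray_code n w G \<longleftrightarrow> cw_gray_code n w G \<and> length G = n choose w"

end

theory Submission
  imports Defs Complex_Main "HOL-Computational_Algebra.Polynomial"
begin

text \<open>
  A step of a code moves a one from position \<open>j\<close> to \<open>j + 1\<close>, hence raises the sum \<open>s(v)\<close> of the
  positions of the ones of \<open>v\<close> by 1 modulo \<open>n\<close>. Let \<open>d = gcd n w > 1\<close> and let \<open>z\<close> be a primitive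
  \<open>d\<close>-th root of unity. Along a cyclic code \<open>z\<^sup>s\<close> is multiplied by \<open>z \<noteq> 1\<close> at each step, so its sum
  over the code vanishes. Over all strings of weight \<open>w\<close>, however, this sum is the coefficient of
  \<open>X\<^sup>w\<close> in \<open>(1 + X)(1 + z X) \<cdots> (1 + z\<^sup>n\<^sup>-\<^sup>1 X) = (1 + c X\<^sup>d)\<^sup>n\<^sup>/\<^sup>d\<close> with \<open>c \<noteq> 0\<close>, which is a nonzero
  multiple of \<open>(n/d) choose (w/d)\<close>. So there is no such code at all.
\<close>

section \<open>Position sums under a code step\<close>

definition pos_sum :: "bool list \<Rightarrow> nat" where
  "pos_sum v = (\<Sum>i<length v. of_bool (v ! i) * i)"

lemma pos_sum_snoc: "pos_sum (v @ [b]) = pos_sum v + of_bool b * length v"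
  by (simp add: pos_sum_def nth_append)

lemma count_list_True_eq_sum: "count_list v True = (\<Sum>i<length v. of_bool (v ! i))"
  by (induction v rule: rev_induct) (simp_all add: nth_append)

text \<open>Only the summand at \<open>j\<close> changes. The additive form avoids subtraction on
  \<open>nat\<close>; \<open>f\<close> is the identity for position sums and constantly 1 for
  weights.\<close>

lemma sum_of_bool_list_update:
  fixes f :: "nat \<Rightarrow> nat"
  assumes "j < length v"
  shows "(\<Sum>i<length v. of_bool (v[j := b] ! i) * f i) + of_bool (v ! j) * f j
       = (\<Sum>i<length v. of_bool (v ! i) * f i) + of_bool b * f j"
proof -
  have "(\<Sum>i\<in>{..<length v} - {j}. of_bool (v[j := b] ! i) * f i)
      = (\<Sum>i\<in>{..<length v} - {j}. of_bool (v ! i) * f i)"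
    by (intro sum.cong) auto
  with assms show ?thesis
    using sum.remove[of "{..<length v}" j "\<lambda>i. of_bool (v[j := b] ! i) * f i"]
      sum.remove[of "{..<length v}" j "\<lambda>i. of_bool (v ! i) * f i"]
    by (simp only: finite_lessThan lessThan_iff nth_list_update_eq ac_simps)
qed

lemma pos_sum_list_update:
  "j < length v \<Longrightarrow> pos_sum (v[j := b]) + of_bool (v ! j) * j = pos_sum v + of_bool b * j"
  using sum_of_bool_list_update[of j v b "\<lambda>i. i"] by (simp add: pos_sum_def)

lemma count_list_True_list_update:
  "j < length v \<Longrightarrow>
    count_list (v[j := b]) True + of_bool (v ! j) = count_list v True + of_bool b"
  using sum_of_bool_list_update[of j v b "\<lambda>_. 1"] by (simp add: count_list_True_eq_sum)

text \<open>A step that keeps the weight but changes the string really moves a one from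
  \<open>j\<close> to its cyclic successor. The position sum then grows by 1, or drops by
  \<open>n - 1\<close> at the wraparound, which \<open>z ^ n = 1\<close> makes invisible.\<close>

lemma power_pos_sum_tau:
  fixes z :: "'a :: idom"
  assumes "v \<in> weight_strings n w" "tau j v \<in> weight_strings n w" "tau j v \<noteq> v"
    and "j < n" "2 \<le> n" and z: "z ^ n = 1"
  shows "z ^ pos_sum (tau j v) = z * z ^ pos_sum v"
proof -
  define k where "k = Suc j mod n"
  have k: "k < n" "k \<noteq> j"
    using assms by (auto simp: k_def mod_Suc)
  have len: "length v = n"
    using assms by (simp add: weight_strings_def)
  have tau: "tau j v = v[j := False, k := True]"
    by (simp add: tau_def k_def len)
  have "of_bool (v ! j) + of_bool (v ! k) = (1 :: nat)"
    using count_list_True_list_update[of j v False]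
      count_list_True_list_update[of k "v[j := False]" True] assms k len
    by (simp add: tau weight_strings_def)
  \<comment> \<open>Exactly one of the two positions holds a one; if it were the target,
    \<open>tau j\<close> would fix \<open>v\<close>.\<close>
  moreover have False if "\<not> v ! j" "v ! k"
  proof -
    have "v[j := False] = v" "v[k := True] = v"
      using that by (metis list_update_id)+
    then show False
      using assms(3) by (simp add: tau)
  qed
  ultimately have vj: "v ! j" "\<not> v ! k"
    by (auto simp: of_bool_def split: if_splits)
  have "pos_sum (tau j v) + j = pos_sum v + k"
    using pos_sum_list_update[of j v False]
      pos_sum_list_update[of k "v[j := False]" True] assms k len vj
    by (simp add: tau)
  then have "z ^ pos_sum (tau j v) * z ^ j = z ^ pos_sum v * z ^ k"
    by (metis power_add)
  \<comment> \<open>At the wraparound \<open>k = 0\<close> and \<open>Suc j = n\<close>.\<close>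
  also have "z ^ k = z ^ Suc j"
    using \<open>j < n\<close> z by (auto simp: k_def mod_Suc)
  finally have "z ^ pos_sum (tau j v) * z ^ j = (z * z ^ pos_sum v) * z ^ j"
    by (simp add: mult_ac)
  moreover have "z \<noteq> 0"
    using z \<open>2 \<le> n\<close> by (auto simp: power_0_left)
  ultimately show ?thesis
    by simp
qed

section \<open>Generating function of position sums\<close>

lemma lists_length_Suc_eq_snoc:
  "{v :: bool list. length v = Suc n}
    = (\<lambda>v. v @ [False]) ` {v. length v = n} \<union> (\<lambda>v. v @ [True]) ` {v. length v = n}"
proof -
  have "\<exists>u. length u = n \<and> (v = u @ [False] \<or> v = u @ [True])"
    if "length v = Suc n" for v :: "bool list"
    using that by (cases v rule: rev_cases) auto
  then show ?thesis
    by auto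
qed

lemma finite_bool_lists_length: "finite {v :: bool list. length v = n}"
  using finite_lists_length_eq[of "UNIV :: bool set" n] by simp

text \<open>Expanding the product, the term \<open>z ^ i\<close> times X is chosen from factor
  \<open>i\<close> exactly when position \<open>i\<close> holds a one. Appending a last bit
  multiplies by one more factor.\<close>

lemma sum_monom_pos_sum:
  fixes z :: "'a :: comm_ring_1"
  shows "(\<Sum>v | length v = n. monom (z ^ pos_sum v) (count_list v True)) = (\<Prod>i<n. [:1, z ^ i:])"
proof (induction n)
  case 0
  then show ?case
    by (simp add: pos_sum_def monom_0)
next
  case (Suc n)
  let ?m = "\<lambda>v. monom (z ^ pos_sum v) (count_list v True)"
  let ?L = "{v :: bool list. length v = n}"
  have "(\<Sum>v | length v = Suc n. ?m v)
      = (\<Sum>v\<in>(\<lambda>v. v @ [False]) ` ?L. ?m v) + (\<Sum>v\<in>(\<lambda>v. v @ [True]) ` ?L. ?m v)"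
    unfolding lists_length_Suc_eq_snoc
    by (intro sum.union_disjoint) (auto simp: finite_bool_lists_length)
  also have "(\<Sum>v\<in>(\<lambda>v. v @ [False]) ` ?L. ?m v) = (\<Sum>v\<in>?L. ?m v)"
    by (subst sum.reindex) (auto simp: inj_on_def pos_sum_snoc)
  also have "(\<Sum>v\<in>(\<lambda>v. v @ [True]) ` ?L. ?m v) = (\<Sum>v\<in>?L. ?m v * monom (z ^ n) 1)"
    by (subst sum.reindex)
      (auto simp: inj_on_def pos_sum_snoc mult_monom power_add intro!: sum.cong)
  also have "(\<Sum>v\<in>?L. ?m v) + (\<Sum>v\<in>?L. ?m v * monom (z ^ n) 1)
      = (\<Sum>v\<in>?L. ?m v) * (1 + monom (z ^ n) 1)"
    by (simp add: sum_distrib_right distrib_left)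
  also have "1 + monom (z ^ n) 1 = [:1, z ^ n:]"
    by (simp add: monom_altdef one_pCons)
  finally show ?case
    using Suc by simp
qed

lemma sum_power_pos_sum_weight_strings:
  fixes z :: "'a :: comm_ring_1"
  shows "(\<Sum>v\<in>weight_strings n w. z ^ pos_sum v) = coeff (\<Prod>i<n. [:1, z ^ i:]) w"
proof -
  have "coeff (\<Prod>i<n. [:1, z ^ i:]) w
      = (\<Sum>v | length v = n. if count_list v True = w then z ^ pos_sum v else 0)"
    by (simp add: coeff_sum flip: sum_monom_pos_sum)
  also have "\<dots> = (\<Sum>v\<in>{v. length v = n} \<inter> {v. count_list v True = w}. z ^ pos_sum v)"
    by (simp add: sum.inter_restrict finite_bool_lists_length)
  also have "{v. length v = n} \<inter> {v. count_list v True = w} = weight_strings n w"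
    by (auto simp: weight_strings_def)
  finally show ?thesis ..
qed

lemma coeff_one_plus_monom_power:
  fixes c :: "'a :: comm_ring_1"
  assumes "d > 0" "k \<le> m"
  shows "coeff ((1 + monom c d) ^ m) (d * k) = of_nat (m choose k) * c ^ k"
proof -
  have "(1 + monom c d) ^ m = (\<Sum>i\<le>m. of_nat (m choose i) * monom (c ^ i) (d * i))"
    using binomial_ring[of "monom c d" 1 m] by (simp add: monom_power add.commute)
  also have "coeff \<dots> (d * k) = (\<Sum>i\<le>m. if i = k then of_nat (m choose k) * c ^ k else 0)"
    unfolding coeff_sum using assms(1)
    by (intro sum.cong) (auto simp: of_nat_poly)
  finally show ?thesis
    using assms(2) by simp
qed

lemma finite_weight_strings: "finite (weight_strings n w)"
  using finite_bool_lists_length[of n] by (rule rev_finite_subset) (auto simp: weight_strings_def)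

text \<open>The case \<open>z = 1\<close> of the generating function, where the product is the
  \<open>n\<close>-th power of 1 + X.\<close>

lemma card_weight_strings:
  assumes "w \<le> n"
  shows "card (weight_strings n w) = n choose w"
proof -
  have "[:1, 1:] = 1 + monom (1 :: int) 1"
    by (simp add: monom_altdef one_pCons)
  then have "int (card (weight_strings n w)) = int (n choose w)"
    using sum_power_pos_sum_weight_strings[where z = "1 :: int" and n = n and w = w]
      coeff_one_plus_monom_power[of 1 w n "1 :: int"] assms
    by simp
  then show ?thesis
    by simp
qed

section \<open>The product at a primitive root of unity\<close>

lemma degree_prod_linear_le:
  fixes z :: "'a :: comm_ring_1"
  shows "degree (\<Prod>i<d. [:1, z ^ i:]) \<le> d"
proof -
  have "degree (\<Prod>i<d. [:1, z ^ i:]) \<le> (\<Sum>i<d. degree [:1, z ^ i:])"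
    using degree_prod_sum_le[of "{..<d}" "\<lambda>i. [:1, z ^ i:]"] by (simp add: o_def)
  also have "\<dots> \<le> (\<Sum>i<d. 1)"
    by (intro sum_mono) simp
  finally show ?thesis
    by simp
qed

text \<open>For \<open>z \<noteq> 0\<close> in a domain every factor has degree exactly 1, so this
  is the leading coefficient.\<close>

lemma coeff_prod_linear_top:
  fixes z :: "'a :: idom"
  assumes "z \<noteq> 0"
  shows "coeff (\<Prod>i<d. [:1, z ^ i:]) d \<noteq> 0"
proof -
  have nz: "[:1, z ^ i:] \<noteq> 0" for i
    by simp
  have "degree (\<Prod>i<d. [:1, z ^ i:]) = d"
    using assms degree_prod_sum_eq[of "{..<d}" "\<lambda>i. [:1, z ^ i:]"] by simp
  then show ?thesis
    by (metis (no_types, lifting) finite_lessThan leading_coeff_0_iff nz prod_zero_iff)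
qed

text \<open>Replacing \<open>X\<close> by \<open>z X\<close> permutes the factors, so a coefficient of \<open>X\<^sup>k\<close> with \<open>z\<^sup>k \<noteq> 1\<close>
  vanishes.\<close>
lemma prod_linear_root_of_unity:
  fixes z :: "'a :: idom"
  assumes "d > 0" "z ^ d = 1" and prim: "\<And>k. 0 < k \<Longrightarrow> k < d \<Longrightarrow> z ^ k \<noteq> 1"
  shows "\<exists>c. c \<noteq> 0 \<and> (\<Prod>i<d. [:1, z ^ i:]) = 1 + monom c d"
proof -
  define Q where "Q = (\<Prod>i<d. [:1, z ^ i:])"
  have "pcompose Q [:0, z:] = (\<Prod>i<d. [:1, z ^ Suc i:])"
    by (simp add: Q_def pcompose_prod pcompose_pCons mult.commute)
  also have "\<dots> = Q"
  proof -
    obtain e where "d = Suc e"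
      using \<open>d > 0\<close> by (cases d) auto
    \<comment> \<open>The last shifted factor, with \<open>z ^ d = 1\<close>, equals the first
      factor of \<open>Q\<close>, with \<open>z ^ 0\<close>.\<close>
    then show ?thesis
      using \<open>z ^ d = 1\<close> unfolding Q_def
      by (subst (2) prod.lessThan_Suc_shift[of _ e, folded \<open>d = Suc e\<close>]) (simp add: mult.commute)
  qed
  finally have rot: "z ^ k * coeff Q k = coeff Q k" for k
    by (metis coeff_pcompose_linear)
  have mid: "coeff Q k = 0" if "0 < k" "k < d" for k
    using rot[of k] prim[OF that] by simp
  have zero: "coeff Q 0 = 1"
    by (simp add: Q_def poly_prod flip: poly_0_coeff_0)
  have "Q = 1 + monom (coeff Q d) d"
  proof (rule poly_eqI)
    fix k
    show "coeff Q k = coeff (1 + monom (coeff Q d) d) k"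
      using mid[of k] zero \<open>d > 0\<close> degree_prod_linear_le[of z d]
      by (cases k d rule: linorder_cases) (auto simp: Q_def coeff_eq_0)
  qed
  moreover have "z \<noteq> 0"
    using assms(1,2) by (auto simp: power_0_left)
  then have "coeff Q d \<noteq> 0"
    unfolding Q_def by (rule coeff_prod_linear_top)
  ultimately show ?thesis
    unfolding Q_def by blast
qed

lemma prod_lessThan_mult_periodic:
  fixes f :: "nat \<Rightarrow> 'a :: comm_monoid_mult"
  assumes "\<And>i. f (i + d) = f i"
  shows "(\<Prod>i<d * m. f i) = (\<Prod>i<d. f i) ^ m"
proof -
  have per: "f (i + k * d) = f i" for i k
    by (induction k) (use assms in \<open>simp_all add: add.assoc[symmetric] add.commute[of d]\<close>)
  have "(\<Prod>i<d * m. f i) = (\<Prod>k<m. \<Prod>i\<in>{k * d..<k * d + d}. f i)"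
    by (simp add: prod.nat_group mult.commute)
  also have "\<dots> = (\<Prod>k<m. \<Prod>i<d. f i)"
  proof (rule prod.cong[OF refl])
    show "(\<Prod>i\<in>{k * d..<k * d + d}. f i) = (\<Prod>i<d. f i)" for k
      using per by (subst prod.atLeastLessThan_shift_0) (simp add: atLeast0LessThan add.commute)
  qed
  finally show ?thesis
    by simp
qed

text \<open>The factors have period \<open>d\<close>, so the product over \<open>i < n\<close> is a
  power of \<open>1 + monom c d\<close>. In characteristic 0 its binomial coefficient stays
  nonzero.\<close>

lemma sum_power_pos_sum_nonzero:
  fixes z :: "'a :: {idom, ring_char_0}"
  assumes "d > 0" "z ^ d = 1" "\<And>k. 0 < k \<Longrightarrow> k < d \<Longrightarrow> z ^ k \<noteq> 1"
    and "d dvd n" "d dvd w" "w \<le> n"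
  shows "(\<Sum>v\<in>weight_strings n w. z ^ pos_sum v) \<noteq> 0"
proof -
  obtain m k where mk: "n = d * m" "w = d * k"
    using assms by (auto elim!: dvdE)
  obtain c where c: "c \<noteq> 0" "(\<Prod>i<d. [:1, z ^ i:]) = 1 + monom c d"
    using prod_linear_root_of_unity[OF assms(1-3)] by blast
  have "(\<Prod>i<n. [:1, z ^ i:]) = (1 + monom c d) ^ m"
    unfolding mk c(2)[symmetric] using assms(2)
    by (intro prod_lessThan_mult_periodic) (simp add: power_add)
  moreover have "k \<le> m"
    using assms mk by simp
  ultimately show ?thesis
    using c(1) \<open>d > 0\<close>
    by (simp add: sum_power_pos_sum_weight_strings mk coeff_one_plus_monom_power)
qed

section \<open>The sum along a cyclic code\<close>

text \<open>Multiplication by \<open>z\<close> shifts the terms cyclically, so the sum is invariant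
  under it and must vanish as \<open>z \<noteq> 1\<close>.\<close>

lemma cyclic_code_sum_power_pos_sum:
  fixes z :: "'a :: idom"
  assumes "cyclic_cw_gray_code n w G" "2 \<le> length G" "z ^ n = 1" "z \<noteq> 1"
  shows "(\<Sum>v\<in>set G. z ^ pos_sum v) = 0"
proof -
  define N where "N = length G"
  \<comment> \<open>Reducing the index modulo \<open>N\<close> turns the closing step, from last
    string to first, into an ordinary one.\<close>
  define a where "a i = z ^ pos_sum (G ! (i mod N))" for i
  have G: "distinct G" "set G \<subseteq> weight_strings n w" "2 \<le> n" "N > 0"
    using assms by (auto simp: cyclic_cw_gray_code_def cw_gray_code_def N_def)
  have step: "a (Suc i) = z * a i" if "i < N" for i
  proof -
    have "\<exists>j<n. G ! (Suc i mod N) = tau j (G ! i)"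
    proof (cases "Suc i = N")
      case True
      have "G \<noteq> []" "\<exists>j<n. hd G = tau j (last G)"
        using assms(1) by (simp_all add: cyclic_cw_gray_code_def)
      moreover have "last G = G ! i"
        using True \<open>G \<noteq> []\<close> by (metis N_def diff_Suc_1 last_conv_nth)
      ultimately show ?thesis
        using True by (simp add: hd_conv_nth)
    next
      case False
      then show ?thesis
        using assms(1) that
        by (simp add: cyclic_cw_gray_code_def cw_gray_code_def N_def)
    qed
    then obtain j where j: "j < n" "G ! (Suc i mod N) = tau j (G ! i)"
      by blast
    \<comment> \<open>Since \<open>N\<close> is at least 2, cyclically consecutive strings differ,
      which rules out steps that change nothing.\<close>
    have "Suc i mod N < N" "Suc i mod N \<noteq> i"
      using that assms(2) by (auto simp: mod_Suc N_def)
    then have "G ! (Suc i mod N) \<noteq> G ! i" "G ! (Suc i mod N) \<in> set G" "G ! i \<in> set G"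
      using G(1) that by (auto simp: N_def nth_eq_iff_index_eq)
    with j G that show ?thesis
      using power_pos_sum_tau[of "G ! i" n w j z] assms(3) by (auto simp: a_def)
  qed
  have "(z - 1) * (\<Sum>i<N. a i) = (\<Sum>i<N. a (Suc i) - a i)"
    by (simp add: sum_distrib_left step left_diff_distrib)
  also have "\<dots> = 0"
    unfolding sum_lessThan_telescope by (simp add: a_def)
  finally have "(\<Sum>i<N. a i) = 0"
    using assms(4) by simp
  moreover have "(\<Sum>v\<in>set G. z ^ pos_sum v) = (\<Sum>i<N. a i)"
    using sum.reindex_bij_betw[OF bij_betw_nth[OF G(1) refl refl], of "\<lambda>v. z ^ pos_sum v"]
    by (simp add: a_def N_def)
  ultimately show ?thesis
    by simp
qed

lemma exists_primitive_root_of_unity: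
  assumes "d > 0"
  shows "\<exists>z :: complex. z ^ d = 1 \<and> (\<forall>k. 0 < k \<longrightarrow> k < d \<longrightarrow> z ^ k \<noteq> 1)"
proof -
  define z where "z = cis (2 * pi / real d)"
  have pow: "z ^ k = cis (2 * pi * real k / real d)" for k
    by (simp add: z_def DeMoivre mult_ac)
  have "inj_on (\<lambda>k. z ^ k) {..<d}"
    using bij_betw_roots_unity[OF assms] by (simp add: pow bij_betw_def)
  then have "z ^ k \<noteq> 1" if "0 < k" "k < d" for k
    using that inj_onD[of "\<lambda>k. z ^ k" "{..<d}" k 0] by auto
  moreover have "z ^ d = 1"
    using assms by (simp add: pow)
  ultimately show ?thesis
    by blast
qed

text \<open>Optimality makes the code exhaust \<open>weight_strings n w\<close>, so for a
  non-coprime pair one and the same sum would be both zero and nonzero.\<close>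

lemma coprime_if_cyclic_optimal:
  assumes cyc: "cyclic_cw_gray_code n w G" and opt: "optimal_cw_gray_code n w G"
  shows "coprime n w"
proof (rule ccontr)
  assume "\<not> coprime n w"
  define d where "d = gcd n w"
  have w: "1 \<le> w" "w < n" and G: "distinct G" "set G \<subseteq> weight_strings n w"
    using cyc by (auto simp: cyclic_cw_gray_code_def cw_gray_code_def)
  have d: "1 < d"
    using \<open>\<not> coprime n w\<close> w by (simp add: d_def coprime_iff_gcd_eq_1 nat_neq_iff)
  obtain z :: complex where z: "z ^ d = 1" "\<And>k. 0 < k \<Longrightarrow> k < d \<Longrightarrow> z ^ k \<noteq> 1"
    using exists_primitive_root_of_unity[of d] d by auto
  have len: "length G = n choose w"
    using opt by (simp add: optimal_cw_gray_code_def)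
  have "card (set G) = card (weight_strings n w)"
    using G(1) len w by (simp add: distinct_card card_weight_strings)
  then have "set G = weight_strings n w"
    using G(2) by (intro card_subset_eq finite_weight_strings)
  moreover have "(\<Sum>v\<in>weight_strings n w. z ^ pos_sum v) \<noteq> 0"
    using z d w by (intro sum_power_pos_sum_nonzero[of d]) (auto simp: d_def)
  moreover have "2 \<le> length G"
  proof -
    \<comment> \<open>Pascal's rule splits the binomial coefficient into two positive
      summands.\<close>
    obtain m u where "n = Suc m" "w = Suc u" "u < m"
      using w by (cases n; cases w) auto
    then have "n choose w = (m choose u) + (m choose w)" "0 < m choose u" "0 < m choose w"
      by simp_all
    then show ?thesis
      using len by linarith
  qed
  moreover have "z ^ n = 1"
    using z(1) by (metis d_def dvd_def gcd_dvd1 power_mult power_one)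
  moreover have "z \<noteq> 1"
    using z(2)[of 1] d by simp
  ultimately show False
    using cyclic_code_sum_power_pos_sum[OF cyc] by metis
qed

theorem theorem8:
  fixes w :: nat
  assumes "w \<ge> 1"
  shows "finite {(n :: nat, G :: bool list list).
    n > w \<and> cyclic_cw_gray_code n w G \<and> optimal_cw_gray_code n w G \<and> gcd n w \<noteq> 1}"
proof -
  have "{(n :: nat, G :: bool list list).
    n > w \<and> cyclic_cw_gray_code n w G \<and> optimal_cw_gray_code n w G \<and> gcd n w \<noteq> 1} = {}"
    using coprime_if_cyclic_optimal by (auto simp: coprime_iff_gcd_eq_1)
  then show ?thesis
    by (simp only: finite.emptyI)
qed

end
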